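(* Let $b$ be a positive integer and let $a_1,a_2$ be integers relatively prime to $b$ with $1\le a_1,a_2\le b-1$. Suppose there are a positive integer $r$ and an integer $s$ such that $b\equiv r\pmod{a_1}$, $b\equiv r\pmod{a_2}$, and $a_1\equiv a_2\equiv s\pmod r$. If $\operatorname{inv}(a_1,b)=\operatorname{inv}(a_2,b)$, then $a_1=a_2$.
   Context: For a permutation $\sigma$ of $\{1,2,\dots,b\}$, its inversion number is $\operatorname{inv}(\sigma)=\#\{(i,j) : 1\le i<j\le b,\ \sigma(i)>\sigma(j)\}$. If $a$ is an integer relatively prime to $b$, let $\sigma_a:\{1,\dots,b\}\to\{1,\dots,b\}$ be the permutation sending $x$ to the unique element of $\{1,\dots,b\}$ congruent to $ax$ modulo $b$, and put $\operatorname{inv}(a,b)=\operatorname{inv}(\sigma_a)$. *)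

theory Defs
  imports "HOL-Number_Theory.Cong" "HOL-Combinatorics.Permutations"
begin

definition inversion_number :: "nat \<Rightarrow> (nat \<Rightarrow> nat) \<Rightarrow> nat" where
  "inversion_number b \<sigma> = card {(i, j). 1 \<le> i \<and> i < j \<and> j \<le> b \<and> \<sigma> i > \<sigma> j}"

text \<open>The representatives are \<open>1, \<dots>, b\<close> rather than \<open>0, \<dots>, b - 1\<close>, so that \<open>b\<close> is mapped to
  itself. Outside \<open>{1..b}\<close> the function is the identity, as \<^const>\<open>permutes\<close> requires.\<close>

definition mult_perm :: "int \<Rightarrow> nat \<Rightarrow> nat \<Rightarrow> nat" where
  "mult_perm a b x =
     (if x \<in> {1..b} then THE y. y \<in> {1..b} \<and> [int y = a * int x] (mod int b) else x)"

definition inv_mult :: "int \<Rightarrow> nat \<Rightarrow> nat" where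
  "inv_mult a b = inversion_number b (mult_perm a b)"

lemma ex1_mult_rep:
  assumes "b > 0"
  shows "\<exists>!y. y \<in> {1..b} \<and> [int y = z] (mod int b)"
proof (rule ex1I)
  let ?y = "nat ((z - 1) mod int b) + 1"
  have "(z - 1) mod int b < int b" "0 \<le> (z - 1) mod int b"
    using assms by simp_all
  moreover have "[(z - 1) mod int b + 1 = z] (mod int b)"
    by (simp add: cong_def mod_simps)
  ultimately show "?y \<in> {1..b} \<and> [int ?y = z] (mod int b)"
    by (auto simp: nat_less_iff Suc_le_eq add.commute)
  fix y assume y: "y \<in> {1..b} \<and> [int y = z] (mod int b)"
  then have "[int y - 1 = z - 1] (mod int b)"
    by (intro cong_diff) auto
  then have "(z - 1) mod int b = int y - 1"
    using y by (auto simp: cong_def)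
  then show "y = ?y"
    using y by auto
qed

lemma mult_perm_spec:
  assumes "x \<in> {1..b}"
  shows "mult_perm a b x \<in> {1..b}" "[int (mult_perm a b x) = a * int x] (mod int b)"
proof -
  from assms have "b > 0" by auto
  from theI'[OF ex1_mult_rep[OF this, of "a * int x"]] assms
  show "mult_perm a b x \<in> {1..b}" "[int (mult_perm a b x) = a * int x] (mod int b)"
    by (auto simp: mult_perm_def)
qed

lemma mult_perm_permutes:
  assumes "b > 0" and "coprime a (int b)"
  shows "mult_perm a b permutes {1..b}"
proof (rule bij_imp_permutes)
  have "inj_on (mult_perm a b) {1..b}"
  proof (rule inj_onI)
    fix x y assume xy: "x \<in> {1..b}" "y \<in> {1..b}" "mult_perm a b x = mult_perm a b y"
    then have "[a * int x = a * int y] (mod int b)"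
      using mult_perm_spec(2)[of x b a] mult_perm_spec(2)[of y b a]
      by (metis cong_sym cong_trans)
    then have "[int x = int y] (mod int b)"
      using assms(2) by (simp add: cong_mult_lcancel)
    then show "x = y"
      using ex1_mult_rep[OF assms(1), of "int y"] xy(1,2) by (metis cong_refl)
  qed
  moreover have "mult_perm a b ` {1..b} \<subseteq> {1..b}"
    using mult_perm_spec(1) by blast
  ultimately show "bij_betw (mult_perm a b) {1..b} {1..b}"
    by (simp add: bij_betw_def endo_inj_surj)
qed (auto simp: mult_perm_def)

end

theory Submission
  imports Defs
begin

text \<open>
  The inversion number is a Dedekind sum in disguise, and the theorem follows from Dedekind
  reciprocity. Let \<open>T(a,b)\<close> be the sum of \<open>x (a x mod b)\<close> over \<open>0 \<le> x < b\<close>, an affine image of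
  \<open>s(a,b)\<close>. A pair \<open>i < j\<close> is inverted exactly when adding the residues of \<open>a i\<close> and \<open>a (j - i)\<close>
  produces a carry modulo \<open>b\<close>, so the number of carries is linear in the residues; summing over all
  pairs gives \<open>2 b inv(a,b) = b (b - 1) (2 b - 1) - 6 T(a,b)\<close> (\<open>inv_mult_residue_moment\<close>). Hence
  equal inversion numbers mean \<open>T(a\<^sub>1,b) = T(a\<^sub>2,b)\<close>.

  Reciprocity (\<open>residue_moment_reciprocity\<close>) expresses \<open>a\<^sup>2 T(a,b) + b\<^sup>2 T(b,a)\<close> as a polynomial.
  Since \<open>T\<close> depends on its first argument only modulo the second, the hypotheses give
  \<open>T(b,a) = T(r,a)\<close> and \<open>T(a,r) = T(s,r)\<close>, so two steps of the Euclidean algorithm, reciprocity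
  for \<open>(a,b)\<close> and then for \<open>(a,r)\<close>, determine \<open>T(a,b)\<close> from \<open>a\<close>, \<open>b\<close>, \<open>r\<close> and a quantity common
  to \<open>a\<^sub>1\<close> and \<open>a\<^sub>2\<close>. The part depending on \<open>a\<close> is a positive multiple of
  \<open>(b - r) ((b r - 1) / a - a)\<close>, which is strictly monotone in \<open>a\<close> when \<open>b \<noteq> r\<close>. When \<open>b = r\<close>,
  the numbers \<open>a\<^sub>1\<close> and \<open>a\<^sub>2\<close> are congruent modulo \<open>b\<close>, hence equal.
\<close>

definition residue_moment :: "nat \<Rightarrow> nat \<Rightarrow> int" where
  "residue_moment a b = (\<Sum>x<b. int x * int (a * x mod b))"

section \<open>Sums of residues and quotients\<close>

lemma residue_moment_cong:
  assumes "[a = a'] (mod b)"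
  shows "residue_moment a b = residue_moment a' b"
proof -
  have "a * x mod b = a' * x mod b" for x
    using assms by (metis cong_def cong_scalar_right)
  then show ?thesis
    by (simp add: residue_moment_def)
qed

lemma bij_betw_mult_mod:
  fixes a b :: nat
  assumes "coprime a b" "b > 0"
  shows "bij_betw (\<lambda>x. a * x mod b) {..<b} {..<b}"
proof -
  have "inj_on (\<lambda>x. a * x mod b) {..<b}"
  proof (rule inj_onI)
    fix x y assume xy: "x \<in> {..<b}" "y \<in> {..<b}" "a * x mod b = a * y mod b"
    then have "[x = y] (mod b)"
      using cong_mult_lcancel_nat[OF assms(1)] by (simp add: cong_def)
    with xy show "x = y"
      by (simp add: cong_def)
  qed
  moreover have "(\<lambda>x. a * x mod b) ` {..<b} \<subseteq> {..<b}"
    using assms(2) by auto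
  ultimately show ?thesis
    by (simp add: bij_betw_def endo_inj_surj)
qed

lemma sum_mult_mod:
  fixes a b :: nat
  assumes "coprime a b" "b > 0"
  shows "(\<Sum>x<b. f (a * x mod b)) = (\<Sum>x<b. f x)"
  using sum.reindex_bij_betw[OF bij_betw_mult_mod[OF assms]] .

lemma sum_int_lessThan: "2 * (\<Sum>x<n. int x) = int n * (int n - 1)"
  by (induction n) (auto simp: algebra_simps)

lemma sum_int_squares_lessThan:
  "6 * (\<Sum>x<n. (int x)\<^sup>2) = int n * (int n - 1) * (2 * int n - 1)"
  by (induction n) (auto simp: algebra_simps power2_eq_square)

lemma int_mod_eq_minus: "int (a * x mod b) = int a * int x - int b * int (a * x div b)"
proof -
  have "int (a * x) = int (b * (a * x div b) + a * x mod b)"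
    by (metis mult_div_mod_eq)
  then have "int a * int x = int b * int (a * x div b) + int (a * x mod b)"
    by (simp only: of_nat_add of_nat_mult)
  then show ?thesis
    by linarith
qed

lemma sum_mult_div:
  assumes "coprime a b" "b > 0"
  shows "2 * (\<Sum>x<b. int (a * x div b)) = (int a - 1) * (int b - 1)"
proof -
  have "(\<Sum>x<b. int x) = (\<Sum>x<b. int (a * x mod b))"
    using sum_mult_mod[OF assms, of int] by simp
  also have "\<dots> = int a * (\<Sum>x<b. int x) - int b * (\<Sum>x<b. int (a * x div b))"
    by (simp only: int_mod_eq_minus sum_subtractf sum_distrib_left)
  finally have "int b * (2 * (\<Sum>x<b. int (a * x div b))) = (int a - 1) * (2 * (\<Sum>x<b. int x))"
    by (simp add: algebra_simps)
  also have "\<dots> = int b * ((int a - 1) * (int b - 1))"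
    by (simp only: sum_int_lessThan) (simp add: algebra_simps)
  finally show ?thesis
    using assms(2) by simp
qed

section \<open>Dedekind reciprocity\<close>

text \<open>By coprimality no lattice point with \<open>0 < y < a\<close> lies on the line \<open>b y = a x\<close>, so the points
  to the right of the line at height \<open>y\<close> start one past the integer part of \<open>b y / a\<close>.\<close>

lemma card_lattice_row:
  fixes a b :: nat
  assumes "coprime a b" "0 < y" "y < a"
  shows "int (card {x\<in>{..<b}. b * y \<le> a * x}) = int b - 1 - int (b * y div a)"
proof -
  have ndvd: "\<not> a dvd b * y"
    using assms by (metis coprime_dvd_mult_right_iff nat_dvd_not_less)
  have row: "b * y \<le> a * x \<longleftrightarrow> b * y div a < x" for x
  proof -
    have "b * y \<le> a * x \<longleftrightarrow> b * y < x * a"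
      using ndvd by (metis dvd_triv_left le_neq_implies_less less_imp_le mult.commute)
    also have "\<dots> \<longleftrightarrow> b * y div a < x"
      using assms by (simp add: div_less_iff_less_mult)
    finally show ?thesis .
  qed
  have "{x\<in>{..<b}. b * y \<le> a * x} = {b * y div a<..<b}"
    unfolding row by auto
  moreover have "b * y div a < b"
  proof (cases "b = 0")
    case True
    with ndvd show ?thesis by simp
  next
    case False
    with assms show ?thesis by (simp add: div_less_iff_less_mult)
  qed
  ultimately show ?thesis
    by simp
qed

lemma square_eq_sum_odd: "(int q)\<^sup>2 = (\<Sum>y=1..q. 2 * int y - 1)"
  by (induction q) (auto simp: power2_eq_square algebra_simps)

text \<open>Summing odd numbers up to each quotient turns the left-hand side into a weighted count of the
  lattice points below the diagonal of an \<open>a\<close> by \<open>b\<close> rectangle. Counting the same points by rows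
  exchanges the roles of \<open>a\<close> and \<open>b\<close>: this is the source of reciprocity.\<close>

lemma sum_square_mult_div:
  fixes a b :: nat
  assumes "coprime a b" "a > 0" "b > 0"
  shows "(\<Sum>x<b. (int (a * x div b))\<^sup>2)
    = (int b - 1) * (int a - 1)\<^sup>2 - 2 * (\<Sum>y<a. int y * int (b * y div a))
      + (\<Sum>y<a. int (b * y div a))"
proof -
  have row: "(int (a * x div b))\<^sup>2 = (\<Sum>y=1..<a. if b * y \<le> a * x then 2 * int y - 1 else 0)"
    if "x < b" for x
  proof -
    have bound: "a * x div b < a"
      using that assms by (simp add: div_less_iff_less_mult)
    have column: "b * y \<le> a * x \<longleftrightarrow> y \<le> a * x div b" for y
      using assms by (simp add: less_eq_div_iff_mult_less_eq mult.commute)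
    have "{1..a * x div b} = {y\<in>{1..<a}. b * y \<le> a * x}"
      unfolding column using bound by auto
    then show ?thesis
      by (simp only: square_eq_sum_odd sum.inter_filter finite_atLeastLessThan)
  qed
  have "(\<Sum>x<b. (int (a * x div b))\<^sup>2)
      = (\<Sum>x<b. \<Sum>y=1..<a. if b * y \<le> a * x then 2 * int y - 1 else 0)"
    using row by simp
  also have "\<dots> = (\<Sum>y=1..<a. \<Sum>x<b. if b * y \<le> a * x then 2 * int y - 1 else 0)"
    by (rule sum.swap)
  also have "\<dots> = (\<Sum>y=1..<a. (2 * int y - 1) * int (card {x\<in>{..<b}. b * y \<le> a * x}))"
    by (simp add: sum.inter_filter[symmetric] mult.commute)
  also have "\<dots> = (\<Sum>y=1..<a. (2 * int y - 1) * (int b - 1 - int (b * y div a)))"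
    using card_lattice_row[OF assms(1)] by (intro sum.cong) auto
  also have "\<dots> = (\<Sum>y<a. (2 * int y - 1) * (int b - 1 - int (b * y div a))) + (int b - 1)"
  proof -
    have "{..<a} = insert 0 {1..<a}"
      using assms(2) by auto
    then show ?thesis by simp
  qed
  also have "(\<Sum>y<a. (2 * int y - 1) * (int b - 1 - int (b * y div a)))
      = (\<Sum>y<a. (int b - 1) * (2 * int y) - (int b - 1)
                   - 2 * (int y * int (b * y div a)) + int (b * y div a))"
    by (intro sum.cong) (auto simp: algebra_simps)
  also have "\<dots> = (int b - 1) * (2 * (\<Sum>y<a. int y)) - int a * (int b - 1)
      - 2 * (\<Sum>y<a. int y * int (b * y div a)) + (\<Sum>y<a. int (b * y div a))"
    by (simp only: sum.distrib sum_subtractf sum_distrib_left[symmetric] sum_constant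
        card_lessThan) (simp add: algebra_simps)
  also have "(int b - 1) * (2 * (\<Sum>y<a. int y)) = (int b - 1) * (int a * (int a - 1))"
    by (simp only: sum_int_lessThan)
  finally show ?thesis
    by (simp add: power2_eq_square algebra_simps)
qed

lemma residue_moment_eq_minus:
  "residue_moment a b
    = int a * (\<Sum>x<b. (int x)\<^sup>2) - int b * (\<Sum>x<b. int x * int (a * x div b))"
  unfolding residue_moment_def int_mod_eq_minus sum_distrib_left sum_subtractf[symmetric]
  by (intro sum.cong) (auto simp: power2_eq_square algebra_simps)

text \<open>Multiplication by \<open>a\<close> permutes the residues, so the squares of \<open>a x mod b\<close> and of \<open>x\<close> have the
  same sum. Expanding the former by the quotients leaves a mixed sum, which is essentially
  \<open>residue_moment a b\<close>, and the sum of squared quotients, which the lattice point count rewrites in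
  terms of \<open>residue_moment b a\<close>.\<close>

theorem residue_moment_reciprocity:
  fixes a b :: nat
  assumes "coprime a b" "a > 0" "b > 0"
  shows "12 * (int a)\<^sup>2 * residue_moment a b + 12 * (int b)\<^sup>2 * residue_moment b a
    = int a * int b * ((int a)\<^sup>2 + (int b)\<^sup>2 + 1)
      + 3 * (int a)\<^sup>2 * (int b)\<^sup>2 * (int a + int b - 3)"
proof -
  define A B where "A = int a" and "B = int b"
  define P P' where "P = (\<Sum>x<b. (int x)\<^sup>2)" and "P' = (\<Sum>x<a. (int x)\<^sup>2)"
  define S S' where "S = (\<Sum>x<b. int x * int (a * x div b))"
    and "S' = (\<Sum>x<a. int x * int (b * x div a))"
  define Q Q' where "Q = (\<Sum>x<b. (int (a * x div b))\<^sup>2)"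
    and "Q' = (\<Sum>x<a. int (b * x div a))"
  define T T' where "T = residue_moment a b" and "T' = residue_moment b a"
  have T: "T = A * P - B * S" and T': "T' = B * P' - A * S'"
    unfolding T_def T'_def A_def B_def P_def P'_def S_def S'_def
    by (rule residue_moment_eq_minus)+
  have P: "6 * P = B * (B - 1) * (2 * B - 1)" and P': "6 * P' = A * (A - 1) * (2 * A - 1)"
    unfolding A_def B_def P_def P'_def by (rule sum_int_squares_lessThan)+
  have Q: "Q = (B - 1) * (A - 1)\<^sup>2 - 2 * S' + Q'"
    unfolding A_def B_def Q_def Q'_def S'_def using assms by (rule sum_square_mult_div)
  have Q': "2 * Q' = (B - 1) * (A - 1)"
    unfolding A_def B_def Q'_def
    using assms by (intro sum_mult_div) (auto simp: coprime_commute)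
  have "P = (\<Sum>x<b. (int (a * x mod b))\<^sup>2)"
    unfolding P_def using sum_mult_mod[OF assms(1,3), of "\<lambda>x. (int x)\<^sup>2"] by simp
  also have "\<dots> = (\<Sum>x<b. A\<^sup>2 * (int x)\<^sup>2 - 2 * A * B * (int x * int (a * x div b))
                    + B\<^sup>2 * (int (a * x div b))\<^sup>2)"
    unfolding int_mod_eq_minus A_def B_def
    by (intro sum.cong) (auto simp: power2_eq_square algebra_simps)
  also have "\<dots> = A\<^sup>2 * P - 2 * A * B * S + B\<^sup>2 * Q"
    unfolding P_def S_def Q_def
    by (simp only: sum.distrib sum_subtractf sum_distrib_left)
  finally have PQ: "A\<^sup>2 * P - 2 * A * B * S = P - B\<^sup>2 * Q"
    by linarith
  have "2 * A\<^sup>2 * T = A * (A\<^sup>2 * P + (A\<^sup>2 * P - 2 * A * B * S))"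
    unfolding T by (simp add: power2_eq_square algebra_simps)
  also have "\<dots> = A * (A\<^sup>2 * P + P - B\<^sup>2 * Q)"
    unfolding PQ by (simp add: algebra_simps)
  also have "\<dots> = A * (A\<^sup>2 + 1) * P - A * B\<^sup>2 * ((B - 1) * (A - 1)\<^sup>2 + Q') + 2 * B\<^sup>2 * (A * S')"
    unfolding Q by (simp add: power2_eq_square algebra_simps)
  also have "A * S' = B * P' - T'"
    unfolding T' by simp
  finally have "12 * A\<^sup>2 * T + 12 * B\<^sup>2 * T'
      = A * (A\<^sup>2 + 1) * (6 * P) - A * B\<^sup>2 * (6 * (B - 1) * (A - 1)\<^sup>2 + 3 * (2 * Q'))
        + 2 * B ^ 3 * (6 * P')"
    by (simp add: power2_eq_square power3_eq_cube algebra_simps)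
  also have "\<dots> = A * B * (A\<^sup>2 + B\<^sup>2 + 1) + 3 * A\<^sup>2 * B\<^sup>2 * (A + B - 3)"
    unfolding P P' Q' by (simp add: power2_eq_square power3_eq_cube algebra_simps)
  finally show ?thesis
    unfolding A_def B_def T_def T'_def .
qed

section \<open>Inversions as carries\<close>

lemma mult_perm_eq_mod:
  assumes "coprime a b" "0 < x" "x < b"
  shows "mult_perm (int a) b x = a * x mod b"
proof -
  have "[mult_perm (int a) b x = a * x] (mod b)"
    using mult_perm_spec(2)[of x b "int a"] assms by (simp add: cong_int_iff[symmetric])
  then have eq: "mult_perm (int a) b x mod b = a * x mod b"
    by (simp add: cong_def)
  have "\<not> b dvd a * x"
    using assms by (metis coprime_commute coprime_dvd_mult_right_iff nat_dvd_not_less)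
  with eq have "mult_perm (int a) b x \<noteq> b"
    by (auto simp: dvd_eq_mod_eq_0)
  with mult_perm_spec(1)[of x b "int a"] assms have "mult_perm (int a) b x < b"
    by simp
  with eq show ?thesis
    by simp
qed

lemma mult_perm_top:
  assumes "b > 0"
  shows "mult_perm a b b = b"
proof -
  have "[int b = a * int b] (mod int b)"
    by (simp add: cong_def)
  then show ?thesis
    using ex1_mult_rep[OF assms, of "a * int b"] mult_perm_spec[of b b a] assms by auto
qed

text \<open>A pair starting at \<open>0\<close> is never inverted by \<open>x \<mapsto> a x mod b\<close>, nor is a pair ending at \<open>b\<close>
  inverted by \<open>mult_perm\<close>. So the window \<open>{1..b}\<close> may be replaced by \<open>{0..<b}\<close>, on which the
  permutation is given by plain residues.\<close>

lemma inv_mult_eq_sum: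
  assumes "coprime a b" "b > 0"
  shows "int (inv_mult (int a) b)
    = (\<Sum>j<b. \<Sum>i<j. if a * i mod b > a * j mod b then 1 else 0)"
proof -
  have "{(i, j). 1 \<le> i \<and> i < j \<and> j \<le> b \<and> mult_perm (int a) b i > mult_perm (int a) b j}
      = prod.swap ` (SIGMA j:{..<b}. {i\<in>{..<j}. a * i mod b > a * j mod b})" (is "?L = ?R")
  proof (intro set_eqI iffI)
    fix p assume "p \<in> ?L"
    then obtain i j where p: "p = (i, j)" "1 \<le> i" "i < j" "j \<le> b"
      and less: "mult_perm (int a) b i > mult_perm (int a) b j"
      by auto
    have "j \<noteq> b"
      using less mult_perm_top[OF assms(2), of "int a"] mult_perm_spec(1)[of i b "int a"] p
      by auto
    with p less show "p \<in> ?R"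
      using mult_perm_eq_mod[OF assms(1)] by (auto simp: image_iff)
  next
    fix p assume "p \<in> ?R"
    then obtain i j where p: "p = (i, j)" "i < j" "j < b" and less: "a * i mod b > a * j mod b"
      by auto
    from less have "i > 0"
      by (cases i) auto
    with p less show "p \<in> ?L"
      using mult_perm_eq_mod[OF assms(1)] by auto
  qed
  then have "inv_mult (int a) b
      = card (SIGMA j:{..<b}. {i\<in>{..<j}. a * i mod b > a * j mod b})"
    by (simp add: inv_mult_def inversion_number_def card_image)
  also have "\<dots> = (\<Sum>j<b. card {i\<in>{..<j}. a * i mod b > a * j mod b})"
    by (subst card_SigmaI) auto
  finally show ?thesis
    by (simp add: sum.inter_filter[symmetric])
qed

lemma carry_eq_residues:
  fixes a b i j :: nat
  assumes "i \<le> j" "b > 0"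
  shows "int b * (if a * i mod b > a * j mod b then 1 else 0)
    = int (a * i mod b) + int (a * (j - i) mod b) - int (a * j mod b)"
proof -
  define u v where "u = a * i mod b" and "v = a * (j - i) mod b"
  have uv: "u < b" "v < b"
    using assms(2) by (simp_all add: u_def v_def)
  have "a * j = a * i + a * (j - i)"
    using assms(1) by (simp add: distrib_left[symmetric])
  then have j: "a * j mod b = (u + v) mod b"
    by (simp add: u_def v_def mod_add_eq)
  have "(u + v) mod b = (if u + v < b then u + v else u + v - b)"
    using uv by (simp add: mod_if)
  then show ?thesis
    using uv unfolding j u_def[symmetric] v_def[symmetric] by auto
qed

lemma sum_lessThan_triangle:
  fixes m :: "nat \<Rightarrow> int"
  shows "(\<Sum>j<n. \<Sum>i<j. m i) = (\<Sum>i<n. (int n - 1 - int i) * m i)"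
proof (induction n)
  case (Suc n)
  have "(\<Sum>j<Suc n. \<Sum>i<j. m i) = (\<Sum>i<n. (int n - 1 - int i) * m i + m i)"
    using Suc by (simp add: sum.distrib)
  then show ?case
    by (simp add: algebra_simps)
qed simp

text \<open>In the sum of all carries the residue of \<open>a x\<close>, for \<open>x > 0\<close>, occurs \<open>b - 1 - x\<close> times as
  the first summand, \<open>b - x\<close> times as the second, and \<open>x\<close> times, subtracted, as the residue of
  the sum; its total weight is \<open>2 b - 1 - 3 x\<close>. The plain sum of the residues is known, and the
  weight \<open>x\<close> yields \<open>residue_moment\<close>.\<close>

theorem inv_mult_residue_moment:
  assumes "coprime a b" "b > 0"
  shows "2 * int b * int (inv_mult (int a) b)
    = int b * (int b - 1) * (2 * int b - 1) - 6 * residue_moment a b"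
proof -
  define m where "m x = int (a * x mod b)" for x
  have inner: "(\<Sum>i<j. m i + m (j - i) - m j) = 2 * (\<Sum>i<j. m i) + m j - int j * m j" for j
  proof -
    have "(\<Sum>i<j. m (j - i)) = (\<Sum>i<j. m (Suc (j - Suc i)))"
      by (intro sum.cong) (auto simp: Suc_diff_Suc)
    also have "\<dots> = (\<Sum>i<j. m (Suc i))"
      by (rule sum.nat_diff_reindex)
    also have "\<dots> = (\<Sum>i<j. m i) + m j"
      using sum.lessThan_Suc_shift[of m j] by (simp add: m_def)
    finally show ?thesis
      by (simp add: sum.distrib sum_subtractf)
  qed
  have "int b * int (inv_mult (int a) b) = (\<Sum>j<b. \<Sum>i<j. m i + m (j - i) - m j)"
    using assms carry_eq_residues[of _ _ b a]
    by (simp add: inv_mult_eq_sum sum_distrib_left m_def)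
  also have "\<dots> = 2 * (\<Sum>j<b. \<Sum>i<j. m i) + (\<Sum>j<b. m j) - (\<Sum>j<b. int j * m j)"
    unfolding inner by (simp only: sum.distrib sum_subtractf sum_distrib_left)
  also have "\<dots> = (\<Sum>x<b. (2 * int b - 1) * m x - 3 * (int x * m x))"
    unfolding sum_lessThan_triangle sum_distrib_left sum.distrib[symmetric]
      sum_subtractf[symmetric]
    by (intro sum.cong) (auto simp: algebra_simps)
  also have "\<dots> = (2 * int b - 1) * (\<Sum>x<b. int x) - 3 * residue_moment a b"
    using sum_mult_mod[OF assms, of int]
    by (simp add: sum_subtractf sum_distrib_left[symmetric] m_def residue_moment_def)
  finally have "2 * int b * int (inv_mult (int a) b)
      = (2 * int b - 1) * (2 * (\<Sum>x<b. int x)) - 6 * residue_moment a b"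
    by simp
  then show ?thesis
    by (simp only: sum_int_lessThan) (simp add: algebra_simps)
qed

section \<open>Two steps of the Euclidean algorithm\<close>

text \<open>As \<open>b\<close> and \<open>r\<close> agree modulo \<open>a\<close>, the reciprocity laws for \<open>(a,b)\<close> and for \<open>(a,r)\<close> both
  contain \<open>residue_moment r a\<close>. Eliminating it, the polynomial terms combine so that a factor
  \<open>a\<close> cancels.\<close>

lemma residue_moment_two_step:
  fixes a b r :: nat
  assumes "coprime a b" "a > 0" "b > 0" "r > 0" "[b = r] (mod a)"
  shows "12 * int a * ((int r)\<^sup>2 * residue_moment a b - (int b)\<^sup>2 * residue_moment a r)
    = int b * int r * (int b - int r) * (int b * int r - 1 - (int a)\<^sup>2)
      + 3 * int a * (int b)\<^sup>2 * (int r)\<^sup>2 * (int b - int r)"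
proof -
  define A B R where "A = int a" and "B = int b" and "R = int r"
  define T U V where "T = residue_moment a b" and "U = residue_moment r a"
    and "V = residue_moment a r"
  have cop: "coprime a r"
    using assms(1,5) by (metis cong_imp_coprime coprime_commute)
  have "12 * A\<^sup>2 * T + 12 * B\<^sup>2 * U = A * B * (A\<^sup>2 + B\<^sup>2 + 1) + 3 * A\<^sup>2 * B\<^sup>2 * (A + B - 3)"
    using residue_moment_reciprocity[OF assms(1,2,3)] residue_moment_cong[OF assms(5)]
    unfolding A_def B_def T_def U_def by simp
  moreover have "12 * A\<^sup>2 * V + 12 * R\<^sup>2 * U
      = A * R * (A\<^sup>2 + R\<^sup>2 + 1) + 3 * A\<^sup>2 * R\<^sup>2 * (A + R - 3)"
    using residue_moment_reciprocity[OF cop assms(2,4)]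
    unfolding A_def R_def V_def U_def .
  ultimately have "R\<^sup>2 * (12 * A\<^sup>2 * T + 12 * B\<^sup>2 * U) - B\<^sup>2 * (12 * A\<^sup>2 * V + 12 * R\<^sup>2 * U)
      = R\<^sup>2 * (A * B * (A\<^sup>2 + B\<^sup>2 + 1) + 3 * A\<^sup>2 * B\<^sup>2 * (A + B - 3))
        - B\<^sup>2 * (A * R * (A\<^sup>2 + R\<^sup>2 + 1) + 3 * A\<^sup>2 * R\<^sup>2 * (A + R - 3))"
    by simp
  then have "A * (12 * A * (R\<^sup>2 * T - B\<^sup>2 * V))
      = A * (B * R * (B - R) * (B * R - 1 - A\<^sup>2) + 3 * A * B\<^sup>2 * R\<^sup>2 * (B - R))"
    by (simp add: power2_eq_square algebra_simps)
  moreover have "A \<noteq> 0"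
    using assms(2) by (simp add: A_def)
  ultimately show ?thesis
    unfolding A_def B_def R_def T_def V_def by simp
qed

theorem proposition2p8:
  fixes b :: nat and a\<^sub>1 a\<^sub>2 r s :: int
  assumes "b > 0"
    and "coprime a\<^sub>1 (int b)" and "coprime a\<^sub>2 (int b)"
    and "1 \<le> a\<^sub>1" and "a\<^sub>1 \<le> int b - 1"
    and "1 \<le> a\<^sub>2" and "a\<^sub>2 \<le> int b - 1"
    and "r > 0"
    and "[int b = r] (mod a\<^sub>1)" and "[int b = r] (mod a\<^sub>2)"
    and "[a\<^sub>1 = s] (mod r)" and "[a\<^sub>2 = s] (mod r)"
    and "inv_mult a\<^sub>1 b = inv_mult a\<^sub>2 b"
  shows "a\<^sub>1 = a\<^sub>2"
proof -
  obtain c d k where nat: "a\<^sub>1 = int c" "a\<^sub>2 = int d" "r = int k"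
    using assms(4,6,8) by (metis nonneg_int_cases order.strict_implies_order order_trans zero_le_one)
  have pos: "c > 0" "d > 0" "k > 0"
    using assms(4,6,8) nat by auto
  have cop: "coprime c b" "coprime d b"
    using assms(2,3) nat by simp_all
  have cong: "[b = k] (mod c)" "[b = k] (mod d)" "[c = d] (mod k)"
    using assms(9,10) cong_trans[OF assms(11) cong_sym[OF assms(12)]] nat
    by (simp_all add: cong_int_iff)
  define B R where "B = int b" and "R = int k"
  define W where "W = 12 * (R\<^sup>2 * residue_moment c b - B\<^sup>2 * residue_moment c k)
    - 3 * B\<^sup>2 * R\<^sup>2 * (B - R)"
  have Tb: "residue_moment d b = residue_moment c b"
    using inv_mult_residue_moment[OF cop(1) assms(1)] inv_mult_residue_moment[OF cop(2) assms(1)]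
      assms(13) nat by simp
  have Tk: "residue_moment d k = residue_moment c k"
    using residue_moment_cong[OF cong(3)] by simp
  have c: "a\<^sub>1 * W = B * R * (B - R) * (B * R - 1 - a\<^sub>1\<^sup>2)"
    using residue_moment_two_step[OF cop(1) pos(1) assms(1) pos(3) cong(1)]
    unfolding W_def B_def R_def nat by (simp add: algebra_simps)
  have d: "a\<^sub>2 * W = B * R * (B - R) * (B * R - 1 - a\<^sub>2\<^sup>2)"
    using residue_moment_two_step[OF cop(2) pos(2) assms(1) pos(3) cong(2)]
    unfolding W_def B_def R_def nat Tb Tk by (simp add: algebra_simps)
  \<comment> \<open>Eliminating \<open>W\<close> exhibits \<open>a\<^sub>2 - a\<^sub>1\<close> as a factor; the last factor is positive.\<close>
  have "B * R * (B - R) * ((a\<^sub>2 - a\<^sub>1) * (B * R - 1 + a\<^sub>1 * a\<^sub>2)) = a\<^sub>2 * (a\<^sub>1 * W) - a\<^sub>1 * (a\<^sub>2 * W)"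
    unfolding c d by (simp add: power2_eq_square algebra_simps)
  then have "B * R * (B - R) * ((a\<^sub>2 - a\<^sub>1) * (B * R - 1 + a\<^sub>1 * a\<^sub>2)) = 0"
    by simp
  moreover have "B * R > 0" "a\<^sub>1 * a\<^sub>2 > 0"
    using assms(1,4,6) pos(3) by (simp_all add: B_def R_def)
  ultimately consider "B = R" | "a\<^sub>1 = a\<^sub>2"
    by auto
  then show ?thesis
  proof cases
    case 1
    then have "[c = d] (mod b)" "c < b" "d < b"
      using cong(3) assms(5,7) nat by (simp_all add: B_def R_def)
    then show ?thesis
      using nat by (simp add: cong_def)
  qed
qed

end
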